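(* Let $D$ be an oriented graph on $n$ vertices with minimum degree $\delta=\delta(D)$ satisfying $3\le\delta\le\frac{n}{3}$, and suppose that $d(u)+d(v)\ge n$ for each pair of non-adjacent vertices $u$ and $v$ in $D$. If there is a vertex $v_0\in V(D)$ such that $d(v_0)=\delta$ and $D[N(v_0)]$ is isomorphic to a tournament, then there is a Hamilton oriented cycle $C$ in $D$ such that $\sigma_{\max}(C)\ge n-\delta-2$.
   Context: An oriented graph is a finite loopless digraph with at most one arc between any pair of vertices; a tournament is an oriented graph with exactly one arc between every pair of distinct vertices. The degree $d(x)$ of a vertex $x$ in $D$ is its degree in the underlying undirected graph $U(D)$ (obtained by removing the orientations of all arcs), i.e. the number of arcs incident with $x$; $\delta(D)$ is the minimum of $d(x)$ over all vertices $x$. Two distinct vertices are adjacent if there is an arc between them (in either direction), and non-adjacent otherwise. $N(x)$ is the set of vertices adjacent to $x$, and $D[X]$ is the subdigraph of $D$ induced by $X$. An oriented cycle in $D$ is a subdigraph $Q$ of $D$ whose underlying graph $U(Q)$ is a cycle in $U(D)$ (arcs need not be consistently oriented); it is Hamilton if it is spanning. For an oriented cycle $C=x_1x_2\dots x_tx_1$ (indices modulo $t$), the arc of $C$ between $x_i$ and $x_{i+1}$ is forward if it is directed from $x_i$ to $x_{i+1}$ and backward if it is directed from $x_{i+1}$ to $x_i$. $\sigma^+(C)$ and $\sigma^-(C)$ denote the numbers of forward and backward arcs of $C$, respectively, and $\sigma_{\max}(C)=\max\{\sigma^+(C),\sigma^-(C)\}$ (which does not depend on the direction of traversal). *)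

theory Defs
  imports "Graph_Theory.Digraph_Isomorphism"
begin

locale oriented_graph = digraph +
  assumes no_opposite_arcs: "u \<rightarrow>\<^bsub>G\<^esub> v \<Longrightarrow> \<not> v \<rightarrow>\<^bsub>G\<^esub> u"

definition adjacent :: "('a, 'b) pre_digraph \<Rightarrow> 'a \<Rightarrow> 'a \<Rightarrow> bool" where
  "adjacent D u v \<longleftrightarrow> u \<noteq> v \<and> (u \<rightarrow>\<^bsub>D\<^esub> v \<or> v \<rightarrow>\<^bsub>D\<^esub> u)"

locale tournament = oriented_graph +
  assumes all_adjacent: "\<lbrakk>u \<in> verts G; v \<in> verts G; u \<noteq> v\<rbrakk> \<Longrightarrow> adjacent G u v"

definition neighbourhood :: "('a, 'b) pre_digraph \<Rightarrow> 'a \<Rightarrow> 'a set" where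
  "neighbourhood D x = {y \<in> verts D. adjacent D x y}"

text \<open>The edge set of the underlying undirected graph \<open>U(D)\<close>; its vertex set is
  that of \<open>D\<close>.\<close>

definition underlying_edges :: "('a, 'b) pre_digraph \<Rightarrow> 'a set set" where
  "underlying_edges D = (\<lambda>e. {tail D e, head D e}) ` arcs D"

definition degree :: "('a, 'b) pre_digraph \<Rightarrow> 'a \<Rightarrow> nat" where
  "degree D x = card {f \<in> underlying_edges D. x \<in> f}"

lemma (in oriented_graph) degree_eq_card_incident_arcs:
  "degree G x = card {e \<in> arcs G. tail G e = x \<or> head G e = x}"
proof -
  have "inj_on (\<lambda>e. {tail G e, head G e}) (arcs G)"
  proof (rule inj_onI)
    fix e f assume ef: "e \<in> arcs G" "f \<in> arcs G"
      and eq: "{tail G e, head G e} = {tail G f, head G f}"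
    have "\<not> (tail G e = head G f \<and> head G e = tail G f)"
      using no_opposite_arcs[of "tail G e" "head G e"] ef
      by (force simp: arcs_ends_conv)
    with eq have "arc_to_ends G e = arc_to_ends G f"
      by (auto simp: arc_to_ends_def doubleton_eq_iff)
    with ef show "e = f" by (blast intro: no_multi_arcs)
  qed
  then have "inj_on (\<lambda>e. {tail G e, head G e}) {e \<in> arcs G. tail G e = x \<or> head G e = x}"
    by (rule inj_on_subset) auto
  moreover have "{f \<in> underlying_edges G. x \<in> f} =
      (\<lambda>e. {tail G e, head G e}) ` {e \<in> arcs G. tail G e = x \<or> head G e = x}"
    by (auto simp: underlying_edges_def)
  ultimately show ?thesis by (simp add: degree_def card_image)
qed

definition min_degree :: "('a, 'b) pre_digraph \<Rightarrow> nat" where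
  "min_degree D = Min (degree D ` verts D)"

text \<open>\<open>is_traversal Q [x\<^sub>1, \<dots>, x\<^sub>t]\<close> says that \<open>U(Q)\<close> is the cycle
  \<open>x\<^sub>1 x\<^sub>2 \<dots> x\<^sub>t x\<^sub>1\<close>, so the list fixes a starting vertex and a direction of traversal.
  List positions start at 0.\<close>

definition is_traversal :: "('a, 'b) pre_digraph \<Rightarrow> 'a list \<Rightarrow> bool" where
  "is_traversal Q xs \<longleftrightarrow>
     3 \<le> length xs \<and> distinct xs \<and> verts Q = set xs \<and>
     underlying_edges Q = {{xs ! i, xs ! (Suc i mod length xs)} | i. i < length xs}"

definition oriented_cycle :: "('a, 'b) pre_digraph \<Rightarrow> ('a, 'b) pre_digraph \<Rightarrow> bool" where
  "oriented_cycle Q D \<longleftrightarrow> subgraph Q D \<and> (\<exists>xs. is_traversal Q xs)"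

definition hamilton_oriented_cycle :: "('a, 'b) pre_digraph \<Rightarrow> ('a, 'b) pre_digraph \<Rightarrow> bool" where
  "hamilton_oriented_cycle Q D \<longleftrightarrow> oriented_cycle Q D \<and> spanning Q D"

definition forward_arcs :: "('a, 'b) pre_digraph \<Rightarrow> 'a list \<Rightarrow> 'b set" where
  "forward_arcs Q xs = {e \<in> arcs Q. \<exists>i < length xs.
     tail Q e = xs ! i \<and> head Q e = xs ! (Suc i mod length xs)}"

definition backward_arcs :: "('a, 'b) pre_digraph \<Rightarrow> 'a list \<Rightarrow> 'b set" where
  "backward_arcs Q xs = {e \<in> arcs Q. \<exists>i < length xs.
     tail Q e = xs ! (Suc i mod length xs) \<and> head Q e = xs ! i}"

definition sigma_plus :: "('a, 'b) pre_digraph \<Rightarrow> 'a list \<Rightarrow> nat" where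
  "sigma_plus Q xs = card (forward_arcs Q xs)"

definition sigma_minus :: "('a, 'b) pre_digraph \<Rightarrow> 'a list \<Rightarrow> nat" where
  "sigma_minus Q xs = card (backward_arcs Q xs)"

text \<open>Reversing the traversal swaps \<open>sigma_plus\<close> and \<open>sigma_minus\<close> and rotating it changes
  neither, so the value of \<open>sigma_max\<close> is the same for all traversals of \<open>Q\<close>.\<close>

definition sigma_max :: "('a, 'b) pre_digraph \<Rightarrow> 'a list \<Rightarrow> nat" where
  "sigma_max Q xs = max (sigma_plus Q xs) (sigma_minus Q xs)"

end

theory Submission
  imports Defs
begin

text \<open>
  Put \<open>s = \<delta> - 2\<close>, let \<open>N\<close> be the neighbourhood of \<open>v\<^sub>0\<close> and \<open>W\<close> the set of vertices other than
  \<open>v\<^sub>0\<close> that are not adjacent to \<open>v\<^sub>0\<close>. The degree condition leaves every \<open>w \<in> W\<close> with at most \<open>s\<close>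
  non-neighbours besides \<open>v\<^sub>0\<close>, while \<open>|N| = s + 2\<close> and \<open>|W| \<ge> 2s + 3\<close>. For suitable distinct
  \<open>a, b \<in> N\<close> there is a Hamilton path of \<open>W \<union> {a, b}\<close> with ends \<open>a\<close> and \<open>b\<close> and at most \<open>s + 2\<close>
  backward arcs. Since \<open>N \<union> {v\<^sub>0}\<close> induces a tournament, its vertices other than \<open>a, b\<close> form a directed
  path, which closes up the cycle at the cost of at most two further backward arcs.

  The path through \<open>W\<close> is grown one vertex at a time. Up to \<open>2s + 4\<close> inner vertices the bound is
  free: of a path and its reverse, one has at most half of the arcs backward. Beyond that, if a new
  vertex \<open>w\<close> fits into no gap of the path without an additional backward arc, then the backward
  arcs concentrate on the runs of consecutive non-neighbours of \<open>w\<close>, and counting shows that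
  exchanging some run for \<open>w\<close> saves enough backward arcs to pay for reinserting the run elsewhere.
\<close>

section \<open>Counting backward steps\<close>

text \<open>The relation is a parameter: for \<open>arc\<close> the backward arcs of a path are
  counted, for \<open>adj\<close> the missing edges of an arbitrary ordering.\<close>

fun breaks :: "('v \<Rightarrow> 'v \<Rightarrow> bool) \<Rightarrow> 'v list \<Rightarrow> nat" where
  "breaks r (x # y # zs) = of_bool (\<not> r x y) + breaks r (y # zs)"
| "breaks r _ = 0"

lemma breaks_append: "breaks r (xs @ x # ys) = breaks r (xs @ [x]) + breaks r (x # ys)"
  by (induction xs rule: induct_list012) auto

lemma breaks_Cons: "zs \<noteq> [] \<Longrightarrow> breaks r (x # zs) = of_bool (\<not> r x (hd zs)) + breaks r zs"
  by (cases zs) auto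

lemma breaks_snoc: "zs \<noteq> [] \<Longrightarrow> breaks r (zs @ [x]) = breaks r zs + of_bool (\<not> r (last zs) x)"
  by (induction zs rule: induct_list012) auto

lemma breaks_le: "breaks r xs \<le> length xs - 1"
  by (induction xs rule: induct_list012) auto

lemma breaks_eq_0_iff: "breaks r xs = 0 \<longleftrightarrow> successively r xs"
  by (induction xs rule: induct_list012) auto

lemma breaks_rev: "breaks r (rev xs) = breaks (\<lambda>x y. r y x) xs"
proof (induction xs)
  case (Cons x xs)
  then show ?case
    by (cases "xs = []") (simp_all add: breaks_snoc breaks_Cons last_rev)
qed simp

lemma breaks_middle:
  "breaks r (A @ x # S @ y # B) = breaks r (A @ [x]) + breaks r (x # S @ [y]) + breaks r (y # B)"
  using breaks_append[of r A x "S @ y # B"] breaks_append[of r "x # S" y B] by simp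

lemma breaks_segment:
  assumes "S \<noteq> []"
  shows "breaks r (A @ x # S @ y # B) =
    breaks r (A @ [x]) + of_bool (\<not> r x (hd S)) + breaks r S + of_bool (\<not> r (last S) y) + breaks r (y # B)"
  using assms by (simp add: breaks_middle breaks_Cons breaks_snoc)

lemma list_segment:
  assumes "i < j" "Suc j < length zs"
  shows "\<exists>A S B. zs = A @ zs ! i # S @ zs ! Suc j # B \<and> S \<noteq> [] \<and> hd S = zs ! Suc i \<and> last S = zs ! j"
proof -
  let ?S = "take (j - i) (drop (Suc i) zs)"
  have ne: "?S \<noteq> []" using assms by auto
  have "drop (Suc i) zs = ?S @ drop (j - i) (drop (Suc i) zs)" by (metis append_take_drop_id)
  also have "drop (j - i) (drop (Suc i) zs) = drop (Suc j) zs" using assms by simp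
  also have "drop (Suc j) zs = zs ! Suc j # drop (Suc (Suc j)) zs"
    using assms by (simp add: Cons_nth_drop_Suc)
  finally have "zs = take i zs @ zs ! i # ?S @ zs ! Suc j # drop (Suc (Suc j)) zs"
    using assms by (metis Suc_lessD id_take_nth_drop less_trans_Suc)
  moreover have "hd ?S = zs ! Suc i"
    using assms by (simp add: hd_drop_conv_nth)
  moreover have "last ?S = zs ! j"
    using assms ne by (simp add: last_conv_nth)
  ultimately show ?thesis using ne by blast
qed

lemma list_gap: "Suc i < length zs \<Longrightarrow> zs = take i zs @ zs ! i # zs ! Suc i # drop (Suc (Suc i)) zs"
  by (metis Cons_nth_drop_Suc Suc_lessD id_take_nth_drop)

locale oriented_relation =
  fixes arc :: "'v \<Rightarrow> 'v \<Rightarrow> bool"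
  assumes arc_asym: "arc x y \<Longrightarrow> \<not> arc y x"
begin

definition adj :: "'v \<Rightarrow> 'v \<Rightarrow> bool" where
  "adj x y \<longleftrightarrow> arc x y \<or> arc y x"

lemma adj_sym: "adj x y \<longleftrightarrow> adj y x"
  by (auto simp: adj_def)

lemma successively_adj_rev: "successively (\<lambda>x y. adj y x) = successively adj"
  by (rule arg_cong[where f = successively]) (auto simp: adj_def fun_eq_iff)

text \<open>An adjacent pair carries an arc in exactly one direction, so it is a break in exactly
  one of the two traversals.\<close>

lemma breaks_plus_breaks_rev:
  "successively adj xs \<Longrightarrow> breaks arc xs + breaks arc (rev xs) = length xs - 1"
  unfolding breaks_rev
  by (induction xs rule: induct_list012) (auto simp: adj_def dest: arc_asym)

text \<open>
  The hypothesis for \<open>R = []\<close> says that inserting \<open>w\<close> into a gap costs at least \<open>k\<close> breaks; for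
  \<open>R \<noteq> []\<close> it says that exchanging the run \<open>R\<close> of non-neighbours for \<open>w\<close> does not pay for reinserting
  \<open>R\<close>. The summand \<open>of_bool (arc w v)\<close> makes the induction an identity: at the vertex \<open>y\<close> after a
  run, exactly one of \<open>arc y w\<close> and \<open>arc w y\<close> holds.
\<close>
lemma run_count_Cons:
  fixes k :: nat
  assumes "1 \<le> k" "adj w v"
    and "\<And>A x R y B. \<lbrakk>v # z = A @ x # R @ y # B; adj w x; adj w y; \<forall>u\<in>set R. \<not> adj w u\<rbrakk>
      \<Longrightarrow> breaks arc (x # R @ [y]) + k \<le> k * length R + breaks arc [x, w, y]"
  shows "breaks arc (v # z) + (k - 1) * length (filter (adj w) (v # z))
    \<le> k * length (filter (\<lambda>u. \<not> adj w u) (v # z)) + (k - 1) + of_bool (arc w v)"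
  using assms(2,3)
proof (induction z arbitrary: v rule: measure_induct_rule[of length])
  case (less z)
  define R where "R = takeWhile (\<lambda>u. \<not> adj w u) z"
  have R: "\<forall>u\<in>set R. \<not> adj w u" unfolding R_def by (auto dest: set_takeWhileD)
  have fR: "filter (adj w) R = []" "filter (\<lambda>u. \<not> adj w u) R = R"
    using R by (auto simp: filter_empty_conv filter_id_conv)
  show ?case
  proof (cases "dropWhile (\<lambda>u. \<not> adj w u) z")
    case Nil
    \<comment> \<open>The last run returns to no neighbour of \<open>w\<close>, so no exchange
      applies; it has at most one break per vertex, and \<open>k \<ge> 1\<close> absorbs
      this.\<close>
    then have z: "R = z" unfolding R_def by (metis append_Nil2 takeWhile_dropWhile_id)
    have "breaks arc (v # z) \<le> length z" using breaks_le[of arc "v # z"] by simp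
    also have "\<dots> \<le> k * length z" using assms(1) by simp
    finally show ?thesis using less.prems(1) fR unfolding z by simp
  next
    case (Cons y B)
    then have z: "z = R @ y # B" unfolding R_def by (metis takeWhile_dropWhile_id)
    have y: "adj w y" using Cons by (metis dropWhile_eq_Cons_conv)
    have run: "breaks arc (v # R @ [y]) + k \<le> k * length R + breaks arc [v, w, y]"
      using less.prems(2)[of "[]" v R y B] less.prems(1) y R z by simp
    have lt: "length B < length z" by (simp add: z)
    have tail: "breaks arc (x # R' @ [y']) + k \<le> k * length R' + breaks arc [x, w, y']"
      if "y # B = A @ x # R' @ y' # B'" "adj w x" "adj w y'" "\<forall>u\<in>set R'. \<not> adj w u" for A x R' y' B'
    proof -
      have "v # z = (v # R @ A) @ x # R' @ y' # B'" using that(1) z by simp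
      from less.prems(2)[OF this that(2-4)] show ?thesis .
    qed
    have IH: "breaks arc (y # B) + (k - 1) * length (filter (adj w) (y # B))
      \<le> k * length (filter (\<lambda>u. \<not> adj w u) (y # B)) + (k - 1) + of_bool (arc w y)"
      by (rule less.IH[OF lt y tail])
    have e: "breaks arc (v # z) = breaks arc (v # R @ [y]) + breaks arc (y # B)"
      using breaks_append[of arc "v # R" y B] z by simp
    have nn: "length (filter (adj w) (v # z)) = 1 + length (filter (adj w) (y # B))"
      using less.prems(1) fR by (simp add: z)
    have no: "length (filter (\<lambda>u. \<not> adj w u) (v # z)) =
       length R + length (filter (\<lambda>u. \<not> adj w u) (y # B))"
      using less.prems(1) fR by (simp add: z)
    have b: "breaks arc [v, w, y] + of_bool (arc w y) = of_bool (arc w v) + 1"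
      using less.prems(1) y by (auto simp: adj_def dest: arc_asym)
    obtain j where k: "k = Suc j" using assms(1) by (cases k) auto
    define f g where "f = length (filter (adj w) (y # B))"
      and "g = length (filter (\<lambda>u. \<not> adj w u) (y # B))"
    show ?thesis
      using run IH b unfolding e nn no f_def[symmetric] g_def[symmetric] k
      by (simp only: diff_Suc_1 distrib_left mult_1_right)
  qed
qed

text \<open>Now \<open>z\<close> may start with non-neighbours of \<open>w\<close>. That initial run
  has at most one break per vertex, and bounding the last summand of \<open>run_count_Cons\<close>
  by 1 turns \<open>k - 1\<close> into \<open>k\<close>.\<close>

lemma run_count:
  fixes k :: nat
  assumes "1 \<le> k"
    and "\<And>A x R y B. \<lbrakk>z = A @ x # R @ y # B; adj w x; adj w y; \<forall>u\<in>set R. \<not> adj w u\<rbrakk>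
      \<Longrightarrow> breaks arc (x # R @ [y]) + k \<le> k * length R + breaks arc [x, w, y]"
  shows "breaks arc z + (k - 1) * length (filter (adj w) z)
    \<le> k * length (filter (\<lambda>u. \<not> adj w u) z) + k"
proof -
  define R where "R = takeWhile (\<lambda>u. \<not> adj w u) z"
  have R: "\<forall>u\<in>set R. \<not> adj w u" unfolding R_def by (auto dest: set_takeWhileD)
  have fR: "filter (adj w) R = []" "filter (\<lambda>u. \<not> adj w u) R = R"
    using R by (auto simp: filter_empty_conv filter_id_conv)
  show ?thesis
  proof (cases "dropWhile (\<lambda>u. \<not> adj w u) z")
    case Nil
    then have z: "R = z" unfolding R_def by (metis append_Nil2 takeWhile_dropWhile_id)
    have "breaks arc z \<le> length z" using breaks_le[of arc z] by simp
    also have "\<dots> \<le> k * length z" using assms(1) by simp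
    finally show ?thesis using fR unfolding z by simp
  next
    case (Cons y B)
    then have z: "z = R @ y # B" unfolding R_def by (metis takeWhile_dropWhile_id)
    have y: "adj w y" using Cons by (metis dropWhile_eq_Cons_conv)
    have tail: "breaks arc (x # R' @ [y']) + k \<le> k * length R' + breaks arc [x, w, y']"
      if "y # B = A @ x # R' @ y' # B'" "adj w x" "adj w y'" "\<forall>u\<in>set R'. \<not> adj w u" for A x R' y' B'
    proof -
      have "z = (R @ A) @ x # R' @ y' # B'" using that(1) z by simp
      from assms(2)[OF this that(2-4)] show ?thesis .
    qed
    have H: "breaks arc (y # B) + (k - 1) * length (filter (adj w) (y # B))
      \<le> k * length (filter (\<lambda>u. \<not> adj w u) (y # B)) + (k - 1) + of_bool (arc w y)"
      by (rule run_count_Cons[OF assms(1) y tail])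
    have e: "breaks arc z = breaks arc (R @ [y]) + breaks arc (y # B)"
      unfolding z by (rule breaks_append)
    have nn: "length (filter (adj w) z) = length (filter (adj w) (y # B))"
      using fR by (simp add: z)
    have no: "length (filter (\<lambda>u. \<not> adj w u) z) =
       length R + length (filter (\<lambda>u. \<not> adj w u) (y # B))"
      using fR by (simp add: z)
    have "breaks arc (R @ [y]) \<le> length R" using breaks_le[of arc "R @ [y]"] by simp
    also have "length R \<le> k * length R" using assms(1) by simp
    finally have r: "breaks arc (R @ [y]) \<le> k * length R" .
    obtain j where k: "k = Suc j" using assms(1) by (cases k) auto
    have "of_bool (arc w y) \<le> (1::nat)" by simp
    then show ?thesis
      using H r unfolding e nn no k by (simp only: diff_Suc_1 distrib_left)
  qed
qed

section \<open>Directed Hamilton paths in tournaments\<close>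

lemma insert_into_directed_path:
  assumes "successively arc P" "\<forall>p\<in>set P. adj v p"
  shows "\<exists>A B. P = A @ B \<and> successively arc (A @ v # B)"
  using assms
proof (induction P)
  case (Cons p P)
  show ?case
  \<comment> \<open>\<open>v\<close> goes directly before the first vertex that it dominates; all
    earlier vertices dominate \<open>v\<close>.\<close>
  proof (cases "arc v p")
    case True
    then show ?thesis using Cons.prems by (intro exI[of _ "[]"] exI[of _ "p # P"]) simp
  next
    case False
    then have pv: "arc p v" using Cons.prems by (auto simp: adj_def)
    obtain A B where AB: "P = A @ B" "successively arc (A @ v # B)"
      using Cons by (auto simp: successively_Cons)
    have "successively arc ((p # A) @ v # B)"
      using AB pv Cons.prems(1) by (cases A) (auto simp: successively_Cons)
    then show ?thesis using AB by (metis append_Cons)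
  qed
qed simp

text \<open>Redei's theorem, by inserting the vertices one at a time.\<close>

lemma directed_hamilton_path:
  assumes "finite K" "\<And>x y. \<lbrakk>x \<in> K; y \<in> K; x \<noteq> y\<rbrakk> \<Longrightarrow> adj x y"
  shows "\<exists>P. distinct P \<and> set P = K \<and> successively arc P"
  using assms
proof (induction K)
  case (insert v K)
  then obtain P where P: "distinct P" "set P = K" "successively arc P" by auto
  moreover have "\<forall>p\<in>set P. adj v p" using insert P by auto
  ultimately obtain A B where "P = A @ B" "successively arc (A @ v # B)"
    using insert_into_directed_path by blast
  then show ?case using P insert.hyps by (intro exI[of _ "A @ v # B"]) auto
qed simp

lemma low_breaks_orientation:
  assumes "successively adj R"
  obtains Q where "Q = R \<or> Q = rev R" "2 * breaks arc Q \<le> length R - 1"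
proof (cases "2 * breaks arc R \<le> length R - 1")
  case False
  then have "2 * breaks arc (rev R) \<le> length R - 1"
    using breaks_plus_breaks_rev[OF assms(1)] by linarith
  then show ?thesis using that by blast
qed (use that in blast)

end

section \<open>Growing a path between two fixed ends\<close>

text \<open>Only vertices of \<open>W\<close> are ever inserted or moved, so the bound is asked of
  them alone; \<open>a\<close> and \<open>b\<close> stay fixed as ends.\<close>

locale linkage = oriented_relation arc for arc :: "'v \<Rightarrow> 'v \<Rightarrow> bool" +
  fixes W :: "'v set" and a b :: 'v and s :: nat
  assumes finite_W: "finite W"
    and ends: "a \<notin> W" "b \<notin> W" "a \<noteq> b"
    and few_non_neighbours:
      "u \<in> W \<Longrightarrow> card {v \<in> insert a (insert b W). v \<noteq> u \<and> \<not> adj u v} \<le> s"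
begin

definition non :: "'v \<Rightarrow> 'v set" where
  "non u = {v \<in> insert a (insert b W). v \<noteq> u \<and> \<not> adj u v}"

text \<open>The direction from \<open>b\<close> to \<open>a\<close> matters, as reversal changes the
  number of breaks; the opposite direction is reached by exchanging \<open>a\<close> and
  \<open>b\<close> in the locale.\<close>

definition hpath :: "'v set \<Rightarrow> 'v list \<Rightarrow> bool" where
  "hpath X P \<longleftrightarrow> distinct P \<and> set P = insert a (insert b X) \<and> hd P = b \<and> last P = a \<and> successively adj P"

lemma finite_non: "finite (non u)"
  using finite_W by (simp add: non_def)

lemma card_non: "u \<in> W \<Longrightarrow> card (non u) \<le> s"
  unfolding non_def by (rule few_non_neighbours)

lemma card_non_Int: "u \<in> W \<Longrightarrow> card (non u \<inter> Y) \<le> s"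
  using card_mono[OF finite_non, of "non u \<inter> Y" u] card_non[of u] by simp

lemma length_hpath:
  assumes "X \<subseteq> W" "hpath X P"
  shows "length P = card X + 2"
proof -
  have "finite X" "a \<notin> insert b X" "b \<notin> X"
    using assms(1) ends finite_subset[OF _ finite_W] by auto
  moreover have "length P = card (insert a (insert b X))"
    using assms(2) distinct_card[of P] by (simp add: hpath_def)
  ultimately show ?thesis by simp
qed

lemma hpath_interior:
  assumes "hpath X (A @ x # S @ y # B)"
  shows "a \<notin> set S" "b \<notin> set S" "set S \<subseteq> X"
proof -
  have d: "distinct (A @ x # S @ y # B)" and l: "last (y # B) = a" and h: "hd (A @ [x]) = b"
    and s: "set (A @ x # S @ y # B) = insert a (insert b X)"
    using assms by (auto simp: hpath_def hd_append)
  have "a \<in> set (y # B)" "b \<in> set (A @ [x])"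
    using l h by (metis last_in_set list.distinct(1), metis hd_in_set snoc_eq_iff_butlast)
  then show ab: "a \<notin> set S" "b \<notin> set S" using d by auto
  then show "set S \<subseteq> X" using s by auto
qed

text \<open>The common form of all path surgery: \<open>S = []\<close> gives an insertion,
  \<open>S' = [u]\<close> an exchange of a run for a vertex, \<open>S' = rev S\<close> a
  reversal.\<close>

lemma hpath_replace:
  assumes "hpath X (A @ x # S @ y # B)"
    and "distinct S'" "set S' \<subseteq> W" "set S' \<inter> (X - set S) = {}"
    and "successively adj (x # S' @ [y])"
  shows "hpath ((X - set S) \<union> set S') (A @ x # S' @ y # B)"
proof -
  let ?P = "A @ x # S @ y # B"
  have P: "distinct ?P" "set ?P = insert a (insert b X)" "hd ?P = b" "last ?P = a"
    "successively adj ?P"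
    using assms(1) by (auto simp: hpath_def)
  have S: "a \<notin> set S" "b \<notin> set S" using hpath_interior[OF assms(1)] by auto
  have rest: "set (A @ x # y # B) = insert a (insert b (X - set S))"
    using P(1,2) S by auto
  have disj: "set S' \<inter> set (A @ x # y # B) = {}"
    unfolding rest using assms(3,4) ends by auto
  have "successively adj (A @ [x])" "successively adj (y # B)"
    using P(5) by (auto simp: successively_append_iff successively_Cons)
  then have "successively adj (A @ x # S' @ y # B)"
    using assms(5) by (auto simp: successively_append_iff successively_Cons hd_append split: if_splits)
  moreover have "distinct (A @ x # S' @ y # B)" using P(1) disj assms(2) by auto
  moreover have "set (A @ x # S' @ y # B) = insert a (insert b ((X - set S) \<union> set S'))"
    using rest by auto
  moreover have "hd (A @ x # S' @ y # B) = b" "last (A @ x # S' @ y # B) = a"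
    using P(3,4) by (auto simp: hd_append)
  ultimately show ?thesis unfolding hpath_def by blast
qed

text \<open>Pigeonhole over the \<open>length P - 1\<close> gaps: each non-neighbour of
  \<open>hd R\<close> blocks only the gap after it, each non-neighbour of \<open>last R\<close> only
  the gap before it. The 2 pays for the two joining arcs.\<close>

lemma insert_segment:
  assumes "X \<subseteq> W" "hpath X P"
    and R: "R \<noteq> []" "distinct R" "set R \<subseteq> W - X" "successively adj R"
    and few: "card (non (hd R) \<inter> set P) + card (non (last R) \<inter> set P) < length P - 1"
  shows "\<exists>P'. hpath (X \<union> set R) P' \<and> breaks arc P' \<le> breaks arc P + breaks arc R + 2"
proof -
  have P: "distinct P" "set P = insert a (insert b X)" using assms(2) by (auto simp: hpath_def)
  define I J where "I = {i. i < length P - 1 \<and> \<not> adj (hd R) (P ! i)}"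
    and "J = {i. i < length P - 1 \<and> \<not> adj (last R) (P ! Suc i)}"
  have RW: "hd R \<in> W - X" "last R \<in> W - X" using R(1,3) by (meson hd_in_set last_in_set subsetD)+
  have mem: "P ! i \<in> non u \<inter> set P" if "i < length P" "\<not> adj u (P ! i)" "u \<in> W - X" for i u
    using that nth_mem[OF that(1)] P(2) assms(1) ends by (auto simp: non_def)
  have "card I \<le> card (non (hd R) \<inter> set P)"
    using P(1) RW mem finite_non
    by (intro card_inj_on_le[where f = "(!) P"]) (auto simp: I_def inj_on_def nth_eq_iff_index_eq)
  moreover have "card J \<le> card (non (last R) \<inter> set P)"
    using P(1) RW mem finite_non
    by (intro card_inj_on_le[where f = "\<lambda>i. P ! Suc i"])
      (auto simp: J_def inj_on_def nth_eq_iff_index_eq)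
  ultimately have "card (I \<union> J) < length P - 1"
    using few card_Un_le[of I J] by linarith
  moreover have "finite (I \<union> J)" by (auto simp: I_def J_def)
  ultimately have "\<not> {..<length P - 1} \<subseteq> I \<union> J"
    using card_mono[of "I \<union> J" "{..<length P - 1}"] by auto
  then obtain i where "i < length P - 1" "i \<notin> I \<union> J" by blast
  then have i: "Suc i < length P" "adj (hd R) (P ! i)" "adj (last R) (P ! Suc i)"
    by (auto simp: I_def J_def)
  obtain A x y B where AB: "P = A @ x # [] @ y # B" and xy: "x = P ! i" "y = P ! Suc i"
    using list_gap[OF i(1)] by auto
  have "successively adj (x # R @ [y])"
    using R(1,4) i xy adj_sym by (auto simp: successively_append_iff successively_Cons)
  then have "hpath (X \<union> set R) (A @ x # R @ y # B)"
    using hpath_replace[of X A x "[]" y B R] assms(2) R AB by auto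
  moreover have "breaks arc (A @ x # R @ y # B) \<le> breaks arc P + breaks arc R + 2"
    using breaks_segment[OF R(1), of arc A x y B] breaks_append[of arc A x "y # B"] AB by simp
  ultimately show ?thesis by blast
qed

lemma length_filter_non:
  assumes "X \<subseteq> W" "hpath X P" "u \<in> W - X"
  shows "length (filter (\<lambda>v. \<not> adj u v) P) \<le> s"
proof -
  have "set (filter (\<lambda>v. \<not> adj u v) P) \<subseteq> non u"
    using assms ends by (auto simp: hpath_def non_def)
  moreover have "distinct (filter (\<lambda>v. \<not> adj u v) P)" using assms(2) by (simp add: hpath_def)
  ultimately show ?thesis
    using card_mono[OF finite_non] card_non[of u] assms(3) by (metis DiffD1 distinct_card le_trans)
qed

lemma swap_run:
  assumes "X \<subseteq> W" "hpath X (A @ x # R @ y # B)" "u \<in> W - X" "adj u x" "adj u y"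
  shows "hpath (insert u (X - set R)) (A @ x # u # y # B)"
    and "breaks arc (A @ x # u # y # B) + breaks arc (x # R @ [y])
      = breaks arc (A @ x # R @ y # B) + breaks arc [x, u, y]"
proof -
  show "hpath (insert u (X - set R)) (A @ x # u # y # B)"
    using hpath_replace[OF assms(2), of "[u]"] assms(3-5) adj_sym by auto
  show "breaks arc (A @ x # u # y # B) + breaks arc (x # R @ [y])
      = breaks arc (A @ x # R @ y # B) + breaks arc [x, u, y]"
    using breaks_middle[of arc A x R y B] breaks_middle[of arc A x "[u]" y B] by simp
qed

text \<open>
  Runs of length at least three satisfy the hypothesis of \<open>run_count\<close> for \<open>k = 2\<close> trivially, so only
  runs of length one or two have to be exchanged; one orientation of such a run has no break.
\<close>
lemma extend_below_budget:
  assumes X: "X \<subseteq> W" "2 * s + 4 \<le> card X" and P: "hpath X P" "breaks arc P \<le> s + 1"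
    and u: "u \<in> W - X"
  shows "\<exists>P'. hpath (insert u X) P' \<and> breaks arc P' \<le> s + 2"
proof (rule ccontr)
  assume "\<not> ?thesis"
  then have no: "s + 2 < breaks arc P'" if "hpath (insert u X) P'" for P'
    using that by (meson not_le)
  have len: "length P = card X + 2" using length_hpath X(1) P(1) by simp
  \<comment> \<open>A single vertex can always be inserted for two breaks, so \<open>P\<close>
    cannot have fewer than \<open>s + 1\<close>.\<close>
  have "\<exists>P'. hpath (X \<union> set [u]) P' \<and> breaks arc P' \<le> breaks arc P + breaks arc [u] + 2"
    using u X(2) card_non_Int[of u "set P"] len by (intro insert_segment[OF X(1) P(1)]) auto
  then have e: "breaks arc P = s + 1" using no P(2) by fastforce
  have "breaks arc (x # R @ [y]) + 2 \<le> 2 * length R + breaks arc [x, u, y]"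
    if dec: "P = A @ x # R @ y # B" and xy: "adj u x" "adj u y" for A x R y B
  proof (rule ccontr)
    assume "\<not> ?thesis"
    then have big: "2 * length R + breaks arc [x, u, y] < breaks arc (x # R @ [y]) + 2" by simp
    define Y where "Y = A @ x # u # y # B"
    have Y: "hpath (insert u (X - set R)) Y"
      "breaks arc Y + breaks arc (x # R @ [y]) = s + 1 + breaks arc [x, u, y]"
      using swap_run[OF X(1) _ u xy, of A R B] P(1) e dec by (auto simp: Y_def)
    show False
    proof (cases "R = []")
      case True
      then show False using no[of Y] Y big by simp
    next
      case False
      have RX: "set R \<subseteq> X" using hpath_interior[of X A x R y B] P(1) dec by simp
      have "distinct R" "successively adj R"
        using P(1) dec by (auto simp: hpath_def successively_append_iff successively_Cons)
      moreover obtain Q where Q: "Q = R \<or> Q = rev R" "2 * breaks arc Q \<le> length R - 1"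
        using low_breaks_orientation \<open>successively adj R\<close> by blast
      \<comment> \<open>The \<open>length R + 1\<close> steps from \<open>x\<close> to
        \<open>y\<close> give at most that many breaks, which \<open>big\<close> contradicts from
        length three on.\<close>
      moreover have R2: "length R \<le> 2" using breaks_le[of arc "x # R @ [y]"] big by simp
      ultimately have Q': "distinct Q" "successively adj Q" "Q \<noteq> []" "set Q = set R"
        "breaks arc Q = 0"
        using False by (auto simp: successively_adj_rev)
      have "hd Q \<in> W" "last Q \<in> W" using Q'(3,4) RX X(1) hd_in_set[of Q] last_in_set[of Q] by auto
      then have "card (non (hd Q) \<inter> set Y) + card (non (last Q) \<inter> set Y) \<le> 2 * s"
        using card_non_Int[of "hd Q" "set Y"] card_non_Int[of "last Q" "set Y"] by linarith
      moreover have "length Y + length R = length P + 1" using dec by (simp add: Y_def)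
      ultimately have few: "card (non (hd Q) \<inter> set Y) + card (non (last Q) \<inter> set Y) < length Y - 1"
        using len X(2) R2 by linarith
      have XR: "insert u (X - set R) \<subseteq> W" "set Q \<subseteq> W - insert u (X - set R)"
        using RX X(1) u Q'(4) by auto
      have "insert u (X - set R) \<union> set Q = insert u X" using RX Q'(4) by auto
      then obtain P' where "hpath (insert u X) P'" "breaks arc P' \<le> breaks arc Y + 2"
        using insert_segment[OF XR(1) Y(1) Q'(3,1) XR(2) Q'(2) few] Q'(5) by auto
      \<comment> \<open>For nonempty \<open>R\<close>, \<open>big\<close> leaves \<open>Y\<close>
        with at most \<open>s\<close> breaks, so the two joining arcs of \<open>Q\<close> are
        affordable.\<close>
      then show False using no[of P'] Y(2) big False by (cases R) auto
    qed
  qed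
  then have "breaks arc P + (2 - 1) * length (filter (adj u) P)
      \<le> 2 * length (filter (\<lambda>v. \<not> adj u v) P) + 2"
    by (intro run_count) auto
  then have "breaks arc P + length (filter (adj u) P)
      \<le> 2 * length (filter (\<lambda>v. \<not> adj u v) P) + 2"
    by simp
  moreover have "length (filter (adj u) P) + length (filter (\<lambda>v. \<not> adj u v) P) = length P"
    by (rule sum_length_filter_compl)
  \<comment> \<open>At most \<open>s\<close> of the at least \<open>2 * s + 6\<close> vertices are
    non-neighbours of \<open>u\<close>, so the left side is at least \<open>2 * s + 7\<close> and
    the right side at most \<open>2 * s + 2\<close>.\<close>
  ultimately show False
    using length_filter_non[OF X(1) P(1) u] e len X(2) by linarith
qed

text \<open>
  A path with as few breaks as possible cannot be improved by reversing a stretch of backward arcs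
  in place, so its long backward stretches are irreversible. This provides non-neighbours inside the
  run, hence fewer outside of it, and so the room needed to reinsert a long run pair by pair.
\<close>
definition irreversible :: "'v list \<Rightarrow> bool" where
  "irreversible R \<longleftrightarrow> (\<forall>A p q M p' q' B. R = A @ p # q # M @ p' # q' # B \<longrightarrow> 2 \<le> length M
     \<longrightarrow> \<not> adj p p' \<or> \<not> adj q q')"

lemma irreversible_Cons: "irreversible (x # R) \<Longrightarrow> irreversible R"
  unfolding irreversible_def by (metis append_Cons)

text \<open>Irreversibility is applied to the first pair \<open>u\<close>, \<open>v\<close> against
  every later pair \<open>R ! i\<close>, \<open>R ! Suc i\<close>; the 3 accounts for the positions
  outside \<open>{2..<length R - 1}\<close>.\<close>

lemma irreversible_card_non:
  assumes "irreversible (u # v # R)" "distinct (u # v # R)" "set R \<subseteq> W"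
  shows "length R \<le> card (non u \<inter> set R) + card (non v \<inter> set R) + 3"
proof -
  define I J where "I = {i \<in> {2..<length R - 1}. \<not> adj u (R ! i)}"
    and "J = {i \<in> {2..<length R - 1}. \<not> adj v (R ! Suc i)}"
  have RW: "R ! i \<in> W" if "i < length R" for i using assms(3) that by auto
  have "i \<in> I \<union> J" if i: "i \<in> {2..<length R - 1}" for i
  proof -
    have "R = take i R @ R ! i # R ! Suc i # drop (Suc (Suc i)) R" by (rule list_gap) (use i in auto)
    then have "u # v # R = [] @ u # v # take i R @ R ! i # R ! Suc i # drop (Suc (Suc i)) R" by simp
    moreover have "2 \<le> length (take i R)" using i by auto
    ultimately have "\<not> adj u (R ! i) \<or> \<not> adj v (R ! Suc i)"
      using assms(1) unfolding irreversible_def by blast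
    then show ?thesis using i by (auto simp: I_def J_def)
  qed
  then have "card {2..<length R - 1} \<le> card (I \<union> J)"
    by (intro card_mono) (auto simp: I_def J_def)
  then have "length R \<le> card I + card J + 3" using card_Un_le[of I J] by simp
  moreover have "card I \<le> card (non u \<inter> set R)"
    using assms(2) RW finite_non by (intro card_inj_on_le[where f = "(!) R"])
      (auto simp: I_def inj_on_def nth_eq_iff_index_eq non_def)
  moreover have "card J \<le> card (non v \<inter> set R)"
    using assms(2) RW finite_non by (intro card_inj_on_le[where f = "\<lambda>i. R ! Suc i"])
      (auto simp: J_def inj_on_def nth_eq_iff_index_eq non_def)
  ultimately show ?thesis by linarith
qed

text \<open>Runs of at most five vertices go in whole, in the better orientation. From a longer run
  the first two vertices are inserted as an arc at the cost of two breaks;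
  \<open>card X + length R\<close> is unchanged, so the induction continues.\<close>

lemma insert_run:
  assumes "X \<subseteq> W" "hpath X P" "distinct R" "set R \<subseteq> W - X" "successively adj R"
    and "2 \<le> length R" "2 * s + 5 \<le> card X + length R" "irreversible R"
  shows "\<exists>P'. hpath (X \<union> set R) P' \<and> breaks arc P' \<le> breaks arc P + length R"
  using assms
proof (induction R arbitrary: X P rule: measure_induct_rule[of length])
  case (less R)
  have len: "length P = card X + 2" using length_hpath less.prems(1,2) by simp
  show ?case
  proof (cases "length R \<le> 5")
    case True
    obtain Q where Q: "Q = R \<or> Q = rev R" "2 * breaks arc Q \<le> length R - 1"
      using low_breaks_orientation less.prems(5) by blast
    then have Q': "distinct Q" "successively adj Q" "Q \<noteq> []" "set Q = set R"
      using less.prems(3,5,6) by (auto simp: successively_adj_rev)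
    have "hd Q \<in> W" "last Q \<in> W" using Q'(3,4) less.prems(4) hd_in_set[of Q] last_in_set[of Q] by auto
    then have "card (non (hd Q) \<inter> set P) + card (non (last Q) \<inter> set P) \<le> 2 * s"
      using card_non_Int[of "hd Q" "set P"] card_non_Int[of "last Q" "set P"] by linarith
    \<comment> \<open>At most \<open>2 * s\<close> gaps are blocked, and a run of at most five
      vertices leaves at least \<open>2 * s + 1\<close> gaps.\<close>
    then have "card (non (hd Q) \<inter> set P) + card (non (last Q) \<inter> set P) < length P - 1"
      using len less.prems(7) True by linarith
    then obtain P' where P': "hpath (X \<union> set R) P'" "breaks arc P' \<le> breaks arc P + breaks arc Q + 2"
      using insert_segment[OF less.prems(1,2) Q'(3,1) _ Q'(2)] less.prems(4) Q'(4) by auto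
    have "breaks arc P' \<le> breaks arc P + length R" using P'(2) Q(2) less.prems(6) by linarith
    then show ?thesis using P'(1) by blast
  next
    case False
    then obtain u v R' where R: "R = u # v # R'"
      by (metis One_nat_def Suc_le_length_iff less.prems(6) numeral_2_eq_2)
    have uv: "u \<in> W" "v \<in> W" "u \<noteq> v" "adj u v" "set R' \<subseteq> W" using less.prems(3-5) by (auto simp: R)
    have "card (non z \<inter> set P) + card (non z \<inter> set R') \<le> s" if "z \<in> W" for z
    proof -
      have "set P \<inter> set R' = {}"
        using less.prems(1,2,4) ends by (auto simp: R hpath_def)
      then have "card (non z \<inter> set P) + card (non z \<inter> set R') = card (non z \<inter> (set P \<union> set R'))"
        by (subst card_Un_disjoint[symmetric]) (auto simp: Int_Un_distrib)
      then show ?thesis using card_non_Int[OF that] by simp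
    qed
    \<comment> \<open>At least \<open>length R' - 3\<close> of the up to \<open>2 * s\<close>
      non-neighbours of \<open>u\<close> and \<open>v\<close> lie in \<open>R'\<close> and so block
      no gap of \<open>P\<close>; this leaves a free gap.\<close>
    from this[OF uv(1)] this[OF uv(2)]
    have few: "card (non u \<inter> set P) + card (non v \<inter> set P) < length P - 1"
      using irreversible_card_non[of u v R'] less.prems(3,7,8) uv(5) len by (simp add: R)
    obtain Q where Q: "Q = [u, v] \<or> Q = [v, u]" "2 * breaks arc Q \<le> 2 - 1"
      using low_breaks_orientation[of "[u, v]"] uv(4) by auto
    then have Q': "distinct Q" "successively adj Q" "Q \<noteq> []" "set Q = {u, v}" "breaks arc Q = 0"
      "card (non (hd Q) \<inter> set P) + card (non (last Q) \<inter> set P) < length P - 1"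
      using uv few by (auto simp: adj_sym[of u])
    then obtain P1 where P1: "hpath (X \<union> {u, v}) P1" "breaks arc P1 \<le> breaks arc P + 2"
      using insert_segment[OF less.prems(1,2) Q'(3,1) _ Q'(2,6)] less.prems(4) by (auto simp: R)
    have "card (X \<union> {u, v}) = card X + 2"
      using less.prems(1,4) uv(3) finite_subset[OF _ finite_W] by (subst card_Un_disjoint) (auto simp: R)
    then have "2 \<le> length R'" "2 * s + 5 \<le> card (X \<union> {u, v}) + length R'"
      using less.prems(7) False by (simp_all add: R)
    moreover have "distinct R'" "set R' \<subseteq> W - (X \<union> {u, v})" "X \<union> {u, v} \<subseteq> W" "length R' < length R"
      using less.prems(1,3,4) by (auto simp: R)
    moreover have "successively adj R'" "irreversible R'"
      using less.prems(5,8) by (auto simp: R successively_Cons dest!: irreversible_Cons)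
    ultimately obtain P' where "hpath (X \<union> {u, v} \<union> set R') P'" "breaks arc P' \<le> breaks arc P1 + length R'"
      using less.IH[of R' "X \<union> {u, v}" P1] P1(1) by blast
    moreover have "X \<union> {u, v} \<union> set R' = X \<union> set R" by (auto simp: R)
    ultimately show ?thesis using P1(2) by (intro exI[of _ P']) (auto simp: R)
  qed
qed

text \<open>At most one of the \<open>length S + 1\<close> steps is forward, so \<open>rev S\<close>
  has at most one break. With the two new joining arcs there are at most three, fewer than
  \<open>length S\<close>.\<close>

lemma reverse_backward_stretch:
  assumes "X \<subseteq> W" "hpath X (A @ p # S @ q # B)" "4 \<le> length S" "length S \<le> breaks arc (p # S @ [q])"
    and "adj p (last S)" "adj (hd S) q"
  shows "\<exists>P'. hpath X P' \<and> breaks arc P' < breaks arc (A @ p # S @ q # B)"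
proof -
  have ne: "S \<noteq> []" using assms(3) by auto
  have S: "distinct S" "successively adj S" "set S \<subseteq> X"
    using assms(2) hpath_interior(3)[OF assms(2)]
    by (auto simp: hpath_def successively_append_iff successively_Cons)
  have "successively adj (p # rev S @ [q])"
    using ne S(2) assms(5,6)
    by (auto simp: successively_append_iff successively_Cons successively_adj_rev hd_rev last_rev)
  then have "hpath (X - set S \<union> set (rev S)) (A @ p # rev S @ q # B)"
    using S assms(1) by (intro hpath_replace[OF assms(2)]) auto
  moreover have "X - set S \<union> set (rev S) = X" using S(3) by auto
  moreover have "breaks arc (A @ p # rev S @ q # B) < breaks arc (A @ p # S @ q # B)"
  proof -
    have "breaks arc (p # S @ [q]) \<le> breaks arc S + 2" "breaks arc (p # rev S @ [q]) \<le> breaks arc (rev S) + 2"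
      using breaks_segment[OF ne, of arc "[]" p q "[]"] breaks_segment[of "rev S" arc "[]" p q "[]"] ne
      by simp_all
    then have "breaks arc (p # rev S @ [q]) < breaks arc (p # S @ [q])"
      using breaks_plus_breaks_rev[OF S(2)] assms(3,4) by linarith
    then show ?thesis using breaks_middle[of arc A p S q B] breaks_middle[of arc A p "rev S" q B] by simp
  qed
  ultimately show ?thesis by auto
qed

text \<open>If \<open>w\<close> does not fit, \<open>extend_below_budget\<close> shows that
  \<open>s + 2\<close> is the least number of breaks on \<open>X\<close>. This minimality makes long
  runs irreversible, so that \<open>run_count\<close> with \<open>k = 1\<close> bounds the breaks by
  \<open>s + 1\<close>.\<close>

lemma extend:
  assumes X: "X \<subseteq> W" "2 * s + 4 \<le> card X" and P: "hpath X P" "breaks arc P \<le> s + 2"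
    and w: "w \<in> W - X"
  shows "\<exists>P'. hpath (insert w X) P' \<and> breaks arc P' \<le> s + 2"
proof (rule ccontr)
  assume "\<not> ?thesis"
  then have no: "s + 2 < breaks arc P'" if "hpath (insert w X) P'" for P'
    using that by (meson not_le)
  have min: "s + 1 < breaks arc P'" if "hpath X P'" for P'
    using extend_below_budget[OF X that _ w] no by (meson not_le)
  then have e: "breaks arc P = s + 2" using P by force
  have len: "length P = card X + 2" using length_hpath X(1) P(1) by simp
  have "breaks arc (x # R @ [y]) + 1 \<le> 1 * length R + breaks arc [x, w, y]"
    if dec: "P = A @ x # R @ y # B" and xy: "adj w x" "adj w y" for A x R y B
  proof (rule ccontr)
    assume "\<not> ?thesis"
    then have big: "length R + breaks arc [x, w, y] \<le> breaks arc (x # R @ [y])" by simp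
    define Y where "Y = A @ x # w # y # B"
    have Y: "hpath (insert w (X - set R)) Y"
      "breaks arc Y + breaks arc (x # R @ [y]) = s + 2 + breaks arc [x, w, y]"
      using swap_run[OF X(1) _ w xy, of A R B] P(1) e dec by (auto simp: Y_def)
    have RX: "set R \<subseteq> X" using hpath_interior[of X A x R y B] P(1) dec by simp
    have R: "distinct R" "successively adj R"
      using P(1) dec by (auto simp: hpath_def successively_append_iff successively_Cons)
    have XR: "insert w (X - set R) \<subseteq> W" "set R \<subseteq> W - insert w (X - set R)"
      "insert w (X - set R) \<union> set R = insert w X"
      using RX X(1) w by auto
    have "card (X - set R) = card X - length R"
      using RX R(1) by (simp add: card_Diff_subset distinct_card)
    moreover have "length R \<le> card X"
      using card_mono[OF finite_subset[OF X(1) finite_W] RX] R(1) by (simp add: distinct_card)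
    moreover have "card (insert w (X - set R)) = card (X - set R) + 1"
      using w finite_subset[OF X(1) finite_W] by simp
    ultimately have cY: "card (insert w (X - set R)) + length R = card X + 1" by simp
    \<comment> \<open>By \<open>big\<close>, the breaks of \<open>Y\<close> and
      \<open>length R\<close> add up to at most \<open>s + 2\<close>: one break may be spent per
      vertex of \<open>R\<close>.\<close>
    consider "R = []" | u where "R = [u]" | "2 \<le> length R"
      by (cases R; cases "tl R") auto
    then show False
    proof cases
      case 1
      then show False using no[of Y] Y big by simp
    next
      case (2 u)
      then have "\<exists>P'. hpath (insert u (insert w (X - set R))) P' \<and> breaks arc P' \<le> s + 2"
        using Y big cY X(2) XR(2) by (intro extend_below_budget[OF XR(1) _ Y(1)]) auto
      then show False using no XR(3) 2 by fastforce
    next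
      case 3
      have "irreversible R"
        unfolding irreversible_def
      proof (intro allI impI, rule ccontr)
        fix A' p q M p' q' B'
        assume R': "R = A' @ p # q # M @ p' # q' # B'" "2 \<le> length M"
          and "\<not> (\<not> adj p p' \<or> \<not> adj q q')"
        then have adj: "adj p p'" "adj q q'" by auto
        define S where "S = q # M @ [p']"
        have P': "P = (A @ x # A') @ p # S @ q' # (B' @ y # B)" using dec R' by (simp add: S_def)
        have "breaks arc (x # R @ [y]) =
          breaks arc (x # A' @ [p]) + breaks arc (p # S @ [q']) + breaks arc (q' # B' @ [y])"
          using breaks_middle[of arc "x # A'" p S q' "B' @ [y]"] by (simp add: R' S_def)
        moreover have "breaks arc (x # A' @ [p]) \<le> length A' + 1" "breaks arc (q' # B' @ [y]) \<le> length B' + 1"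
          using breaks_le[of arc "x # A' @ [p]"] breaks_le[of arc "q' # B' @ [y]"] by simp_all
        moreover have "length R = length A' + length S + length B' + 2" by (simp add: R' S_def)
        \<comment> \<open>At most one step of \<open>x # R @ [y]\<close> is forward, hence at most
          one within the stretch from \<open>p\<close> to \<open>q'\<close>.\<close>
        ultimately have "length S \<le> breaks arc (p # S @ [q'])" using big by linarith
        then obtain P'' where "hpath X P''" "breaks arc P'' < breaks arc P"
          using reverse_backward_stretch[OF X(1), of "A @ x # A'" p S q' "B' @ y # B"] P(1) P' adj R'(2)
          by (auto simp: S_def)
        then show False using min[of P''] e by linarith
      qed
      then obtain P' where "hpath (insert w X) P'" "breaks arc P' \<le> breaks arc Y + length R"
        using insert_run[OF XR(1) Y(1) R(1) XR(2) R(2) 3] cY X(2) XR(3) by auto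
      then show False using no[of P'] Y(2) big by linarith
    qed
  qed
  then have "breaks arc P + (1 - 1) * length (filter (adj w) P)
      \<le> 1 * length (filter (\<lambda>v. \<not> adj w v) P) + 1"
    by (intro run_count) auto
  then show False using length_filter_non[OF X(1) P(1) w] e by simp
qed

lemma extend_to_all:
  assumes X: "X \<subseteq> W" "2 * s + 4 \<le> card X" and P: "hpath X P" "breaks arc P \<le> s + 2"
  shows "\<exists>P'. hpath W P' \<and> breaks arc P' \<le> s + 2"
proof -
  have "finite F \<Longrightarrow> F \<subseteq> W - X \<Longrightarrow> \<exists>P'. hpath (F \<union> X) P' \<and> breaks arc P' \<le> s + 2" for F
  proof (induction F rule: finite_induct)
    case (insert w F)
    then obtain P' where P': "hpath (F \<union> X) P'" "breaks arc P' \<le> s + 2" by auto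
    have "card X \<le> card (F \<union> X)"
      using insert.prems insert.hyps finite_subset[OF X(1) finite_W] by (intro card_mono) auto
    then show ?case using extend[OF _ _ P', of w] insert X by auto
  qed (use P in auto)
  from this[of "W - X"] show ?thesis using X(1) finite_W by (simp add: Un_absorb2)
qed

section \<open>A starting path, by an Ore-type argument\<close>

lemma exists_hpath:
  assumes "X \<subseteq> W" "2 * s + 3 \<le> card X" "w \<in> X" "w' \<in> X" "w \<noteq> w'" "adj b w" "adj w' a"
  shows "\<exists>P. hpath X P"
proof -
  have fX: "finite X" using assms(1) finite_W finite_subset by blast
  define ok where "ok zs \<longleftrightarrow> distinct zs \<and> set zs = X \<and> hd zs = w \<and> last zs = w'" for zs
  obtain ys where ys: "set ys = X - {w, w'}" "distinct ys"
    using finite_distinct_list[of "X - {w, w'}"] fX by auto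
  have "ok (w # ys @ [w'])" using ys assms(3-5) by (auto simp: ok_def)
  \<comment> \<open>An ordering with the fewest missing edges between the prescribed ends is shown
    to have none.\<close>
  then obtain zs where zs: "ok zs" and min: "\<And>zs'. ok zs' \<Longrightarrow> breaks adj zs \<le> breaks adj zs'"
    using ex_has_least_nat[of ok _ "breaks adj"] by blast
  have dz: "distinct zs" "set zs = X" "hd zs = w" "last zs = w'" using zs by (auto simp: ok_def)
  have len: "length zs = card X" using dz by (metis distinct_card)
  have "successively adj zs"
  proof (rule ccontr)
    assume "\<not> ?thesis"
    \<comment> \<open>reversing a segment next to a missing edge, as in the proof of Ore's theorem\<close>
    then obtain i where i: "Suc i < length zs" "\<not> adj (zs ! i) (zs ! Suc i)"
      by (auto simp: successively_conv_nth)
    define I J where "I = {j. j < length zs - 1 \<and> j \<noteq> i \<and> \<not> adj (zs ! i) (zs ! j)}"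
      and "J = {j. j < length zs - 1 \<and> j \<noteq> i \<and> \<not> adj (zs ! Suc i) (zs ! Suc j)}"
    have iW: "zs ! i \<in> W" "zs ! Suc i \<in> W"
      using i(1) dz(2) assms(1) by (metis Suc_lessD nth_mem subsetD, metis nth_mem subsetD)
    have mem: "zs ! j \<in> non (zs ! k)" if "j < length zs" "k < length zs" "j \<noteq> k" "\<not> adj (zs ! k) (zs ! j)" for j k
      using that dz(1,2) assms(1) nth_mem[OF that(1)] by (auto simp: non_def nth_eq_iff_index_eq)
    have "card I \<le> card (non (zs ! i))"
      using dz(1) i(1) mem finite_non
      by (intro card_inj_on_le[where f = "(!) zs"]) (auto simp: I_def inj_on_def nth_eq_iff_index_eq)
    moreover have "card J \<le> card (non (zs ! Suc i))"
      using dz(1) i(1) mem finite_non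
      by (intro card_inj_on_le[where f = "\<lambda>j. zs ! Suc j"]) (auto simp: J_def inj_on_def nth_eq_iff_index_eq)
    moreover have "card (insert i (I \<union> J)) \<le> card I + card J + 1"
      using card_Un_le[of I J] card_insert_le_m1 by (simp add: I_def J_def card_insert_if)
    \<comment> \<open>At most \<open>2 * s + 1\<close> positions are excluded, out of at least
      \<open>2 * s + 2\<close>.\<close>
    ultimately have "card (insert i (I \<union> J)) < card {..<length zs - 1}"
      using card_non[OF iW(1)] card_non[OF iW(2)] assms(2) len by simp
    moreover have "finite (insert i (I \<union> J))" by (simp add: I_def J_def)
    ultimately have "\<not> {..<length zs - 1} \<subseteq> insert i (I \<union> J)"
      using card_mono leD by blast
    then obtain j where "j < length zs - 1" "j \<notin> insert i (I \<union> J)" by blast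
    then have j: "Suc j < length zs" "j \<noteq> i" "adj (zs ! i) (zs ! j)" "adj (zs ! Suc i) (zs ! Suc j)"
      by (auto simp: I_def J_def)
    \<comment> \<open>Reversal alters only the two boundary pairs: both become edges, and at least
      one was missing. The missing pair is at the left end when \<open>i < j\<close> and at the
      right end when \<open>j < i\<close>.\<close>
    have bad: "\<exists>zs'. ok zs' \<and> breaks adj zs' < breaks adj zs"
      if dec: "zs = A @ x # S @ y # B" and S: "S \<noteq> []" "adj x (last S)" "adj (hd S) y"
        "\<not> adj x (hd S) \<or> \<not> adj (last S) y" for A x S y B
    proof -
      have "breaks adj (rev S) = breaks adj S"
        unfolding breaks_rev by (rule arg_cong[where f = "\<lambda>r. breaks r S"]) (auto simp: adj_def fun_eq_iff)
      then have "breaks adj (A @ x # rev S @ y # B) < breaks adj zs"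
        using breaks_segment[OF S(1), of adj A x y B] breaks_segment[of "rev S" adj A x y B] S
        by (auto simp: dec hd_rev last_rev)
      moreover have "ok (A @ x # rev S @ y # B)"
        using zs by (auto simp: ok_def dec hd_append)
      ultimately show ?thesis by blast
    qed
    show False
    proof (cases "i < j")
      case True
      obtain A S B where "zs = A @ zs ! i # S @ zs ! Suc j # B" "S \<noteq> []" "hd S = zs ! Suc i" "last S = zs ! j"
        using list_segment[OF True j(1)] by blast
      then show False using bad[of A "zs ! i" S "zs ! Suc j" B] i j min leD by metis
    next
      case False
      then have "j < i" using j(2) by simp
      then obtain A S B where "zs = A @ zs ! j # S @ zs ! Suc i # B" "S \<noteq> []" "hd S = zs ! Suc j" "last S = zs ! i"
        using list_segment[of j i zs] i(1) by blast
      then show False using bad[of A "zs ! j" S "zs ! Suc i" B] i j min leD adj_sym by metis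
    qed
  qed
  moreover have "zs \<noteq> []" using dz(2) assms(3) by auto
  ultimately have "hpath X (b # zs @ [a])"
    using dz assms ends by (auto simp: hpath_def successively_append_iff successively_Cons)
  then show ?thesis by blast
qed

text \<open>It lets a path be grown in whichever direction has fewer breaks.\<close>

lemma linkage_swap: "linkage arc W b a s"
proof unfold_locales
  show "card {v \<in> insert b (insert a W). v \<noteq> u \<and> \<not> adj u v} \<le> s" if "u \<in> W" for u
    using few_non_neighbours[OF that] by (simp add: insert_commute)
qed (use finite_W ends in auto)

lemma spanning_linkage:
  assumes "2 * s + 3 \<le> card W" "w \<in> W" "w' \<in> W" "w \<noteq> w'" "adj b w" "adj w' a"
  obtains Z where "distinct Z" "set Z = insert a (insert b W)" "{hd Z, last Z} = {a, b}"
    "successively adj Z" "breaks arc Z \<le> s + 2"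
proof -
  interpret swap: linkage arc W b a s by (rule linkage_swap)
  \<comment> \<open>The 2 leaves space for \<open>w\<close> and \<open>w'\<close>. Size
    \<open>2 * s + 4\<close> is the largest at which half of the arcs, rounded down, is at most
    \<open>s + 2\<close>, and the smallest at which \<open>extend_to_all\<close> takes over.\<close>
  define k where "k = min (card W) (2 * s + 4) - 2"
  have "k \<le> card (W - {w, w'})" using assms(2-4) finite_W by (simp add: card_Diff_subset k_def)
  then obtain X' where X': "X' \<subseteq> W - {w, w'}" "card X' = k"
    using obtain_subset_with_card_n by metis
  define X where "X = insert w (insert w' X')"
  have X: "X \<subseteq> W" "w \<in> X" "w' \<in> X" using X' assms(2,3) by (auto simp: X_def)
  have "finite X'" using X' finite_W finite_subset by blast
  then have cX: "card X = min (card W) (2 * s + 4)"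
    using X' assms(1,4) by (auto simp: X_def k_def card_insert_if)
  then obtain P where P: "hpath X P" using exists_hpath[OF X(1) _ X(2,3)] assms by auto
  have sP: "successively adj P" using P by (simp add: hpath_def)
  have "length P \<le> 2 * s + 6" using length_hpath[OF X(1) P] cX by simp
  then have "breaks arc P \<le> s + 2 \<or> breaks arc (rev P) \<le> s + 2"
    using breaks_plus_breaks_rev[OF sP] by linarith
  then show thesis
  proof
    assume le: "breaks arc P \<le> s + 2"
    have "\<exists>Z. hpath W Z \<and> breaks arc Z \<le> s + 2"
    proof (cases "X = W")
      case False
      then have "card X < card W" using X(1) finite_W psubset_card_mono by blast
      then show ?thesis using extend_to_all[OF X(1) _ P le] cX by simp
    qed (use P le in blast)
    then show thesis using that unfolding hpath_def by blast
  next
    assume le: "breaks arc (rev P) \<le> s + 2"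
    have P': "swap.hpath X (rev P)"
      using P by (auto simp: hpath_def swap.hpath_def successively_adj_rev hd_rev last_rev)
    have "\<exists>Z. swap.hpath W Z \<and> breaks arc Z \<le> s + 2"
    proof (cases "X = W")
      case False
      then have "card X < card W" using X(1) finite_W psubset_card_mono by blast
      then show ?thesis using swap.extend_to_all[OF X(1) _ P' le] cX by simp
    qed (use P' le in blast)
    then show thesis using that unfolding swap.hpath_def by (metis insert_commute)
  qed
qed

end

section \<open>From lists to oriented cycles\<close>

lemma breaks_append_le: "breaks r (xs @ ys) \<le> breaks r xs + 1 + breaks r ys"
proof (cases ys)
  case (Cons y zs)
  then show ?thesis
    by (cases "xs = []") (simp_all add: breaks_append[of r xs y zs] breaks_snoc)
qed simp

lemma breaks_eq_card: "breaks r xs = card {i. Suc i < length xs \<and> \<not> r (xs ! i) (xs ! Suc i)}"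
proof (induction xs rule: induct_list012)
  case (3 x y zs)
  let ?I = "{i. Suc i < length (y # zs) \<and> \<not> r ((y # zs) ! i) ((y # zs) ! Suc i)}"
  have fin: "finite ?I" by (rule finite_subset[of _ "{..<length zs}"]) auto
  have "{i. Suc i < length (x # y # zs) \<and> \<not> r ((x # y # zs) ! i) ((x # y # zs) ! Suc i)}
      = (if r x y then {} else {0}) \<union> Suc ` ?I"
  proof (rule set_eqI)
    fix i show "i \<in> {i. Suc i < length (x # y # zs) \<and> \<not> r ((x # y # zs) ! i) ((x # y # zs) ! Suc i)}
      \<longleftrightarrow> i \<in> (if r x y then {} else {0}) \<union> Suc ` ?I"
      by (cases i) auto
  qed
  moreover have "card ((if r x y then {} else {0}) \<union> Suc ` ?I) = of_bool (\<not> r x y) + card ?I"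
    using fin by (subst card_Un_disjoint) (auto simp: card_image)
  ultimately show ?case using "3.IH"(2) by simp
qed auto

text \<open>Repeating the first entry at the end turns cyclic successors into list successors, so
  \<open>breaks\<close> also sees the closing arc.\<close>

lemma closed_list_nth:
  assumes "i < length xs"
  shows "(xs @ [hd xs]) ! i = xs ! i" "(xs @ [hd xs]) ! Suc i = xs ! (Suc i mod length xs)"
proof -
  show "(xs @ [hd xs]) ! i = xs ! i" using assms by (simp add: nth_append)
  have "hd xs = xs ! 0" using assms by (intro hd_conv_nth) auto
  then show "(xs @ [hd xs]) ! Suc i = xs ! (Suc i mod length xs)"
    using assms by (cases "Suc i < length xs") (auto simp: nth_append mod_Suc)
qed

context oriented_graph
begin

lemma adjacent_iff: "adjacent G u v \<longleftrightarrow> u \<rightarrow>\<^bsub>G\<^esub> v \<or> v \<rightarrow>\<^bsub>G\<^esub> u"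
  using no_opposite_arcs by (auto simp: adjacent_def)

lemma degree_eq_card_neighbourhood: "degree G x = card (neighbourhood G x)"
proof -
  have "{f \<in> underlying_edges G. x \<in> f} = (\<lambda>y. {x, y}) ` neighbourhood G x"
  proof (intro set_eqI iffI)
    fix f assume "f \<in> {f \<in> underlying_edges G. x \<in> f}"
    then obtain e where e: "e \<in> arcs G" "f = {tail G e, head G e}" "x = tail G e \<or> x = head G e"
      by (auto simp: underlying_edges_def)
    have "tail G e \<rightarrow>\<^bsub>G\<^esub> head G e" using e(1) by (auto simp: arcs_ends_conv)
    then show "f \<in> (\<lambda>y. {x, y}) ` neighbourhood G x"
      using e by (auto simp: neighbourhood_def adjacent_iff)
  next
    fix f assume "f \<in> (\<lambda>y. {x, y}) ` neighbourhood G x"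
    then obtain y where "f = {x, y}" "x \<rightarrow>\<^bsub>G\<^esub> y \<or> y \<rightarrow>\<^bsub>G\<^esub> x"
      by (auto simp: neighbourhood_def adjacent_iff)
    then show "f \<in> {f \<in> underlying_edges G. x \<in> f}"
      by (auto simp: underlying_edges_def arcs_ends_conv)
  qed
  moreover have "inj_on (\<lambda>y. {x, y}) (neighbourhood G x)"
    by (auto simp: inj_on_def doubleton_eq_iff)
  ultimately show ?thesis by (simp add: degree_def card_image)
qed

text \<open>\<open>C\<close> keeps the arcs between cyclically consecutive vertices. Each position
  is either a break or yields a forward arc, whose tail determines the position.\<close>

lemma hamilton_oriented_cycle_of_list:
  assumes xs: "distinct xs" "set xs = verts G" "3 \<le> length xs"
    and adj: "successively (adjacent G) (xs @ [hd xs])"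
  shows "\<exists>C. hamilton_oriented_cycle C G \<and> is_traversal C xs
    \<and> length xs \<le> sigma_plus C xs + breaks (dominates G) (xs @ [hd xs])"
proof -
  let ?n = "length xs"
  define C where "C = \<lparr>verts = verts G,
    arcs = {e \<in> arcs G. \<exists>i < ?n. {tail G e, head G e} = {xs ! i, xs ! (Suc i mod ?n)}},
    tail = tail G, head = head G\<rparr>"
  have step: "adjacent G (xs ! i) (xs ! (Suc i mod ?n))" if "i < ?n" for i
    using adj that closed_list_nth[OF that] by (auto simp: successively_conv_nth)
  have sub: "subgraph C G"
    by (intro subgraphI) (auto simp: C_def compatible_def wf_digraph intro!: wf_digraph.intro)
  have "underlying_edges C = {{xs ! i, xs ! (Suc i mod ?n)} | i. i < ?n}"
  proof (intro set_eqI iffI)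
    fix f assume "f \<in> {{xs ! i, xs ! (Suc i mod ?n)} | i. i < ?n}"
    then obtain i where i: "i < ?n" "f = {xs ! i, xs ! (Suc i mod ?n)}" by auto
    have "\<exists>e\<in>arcs G. {tail G e, head G e} = f"
      using step[OF i(1)] i(2) by (auto simp: adjacent_iff arcs_ends_conv insert_commute)
    then obtain e where "e \<in> arcs G" "{tail G e, head G e} = f" by blast
    then show "f \<in> underlying_edges C" using i by (auto simp: underlying_edges_def C_def)
  qed (auto simp: underlying_edges_def C_def)
  then have trav: "is_traversal C xs" using xs by (simp add: is_traversal_def C_def)
  define F where "F = {i. i < ?n \<and> xs ! i \<rightarrow>\<^bsub>G\<^esub> xs ! (Suc i mod ?n)}"
  define B where "B = {i. i < ?n \<and> \<not> xs ! i \<rightarrow>\<^bsub>G\<^esub> xs ! (Suc i mod ?n)}"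
  have "\<forall>i\<in>F. \<exists>e\<in>arcs G. tail G e = xs ! i \<and> head G e = xs ! (Suc i mod ?n)"
    by (auto simp: F_def arcs_ends_conv)
  then obtain g where g: "\<And>i. i \<in> F \<Longrightarrow> g i \<in> arcs G \<and> tail G (g i) = xs ! i \<and> head G (g i) = xs ! (Suc i mod ?n)"
    by metis
  have "inj_on g F"
  proof (rule inj_onI)
    fix i j assume "i \<in> F" "j \<in> F" "g i = g j"
    then have "xs ! i = xs ! j" "i < ?n" "j < ?n" using g[of i] g[of j] by (auto simp: F_def)
    then show "i = j" using xs(1) by (simp add: nth_eq_iff_index_eq)
  qed
  moreover have "g ` F \<subseteq> forward_arcs C xs"
    using g by (fastforce simp: forward_arcs_def C_def F_def)
  moreover have "finite (forward_arcs C xs)"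
    by (rule finite_subset[OF _ finite_arcs]) (auto simp: forward_arcs_def C_def)
  ultimately have "card F \<le> sigma_plus C xs" unfolding sigma_plus_def by (rule card_inj_on_le)
  moreover have "breaks (dominates G) (xs @ [hd xs]) = card B"
    unfolding breaks_eq_card B_def
    using closed_list_nth[of _ xs] by (intro arg_cong[where f = card]) auto
  moreover have "F \<union> B = {..<?n}" by (auto simp: F_def B_def)
  then have "?n \<le> card F + card B" using card_Un_le[of F B] by simp
  ultimately have "?n \<le> sigma_plus C xs + breaks (dominates G) (xs @ [hd xs])" by linarith
  moreover have "hamilton_oriented_cycle C G"
    using sub trav by (auto simp: hamilton_oriented_cycle_def oriented_cycle_def spanning_def C_def)
  ultimately show ?thesis using trav by blast
qed

text \<open>Arcs of \<open>T\<close> pull back to arcs of \<open>G\<close> with the right ends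
  because the vertex map is injective on \<open>X\<close>.\<close>

lemma clique_if_iso_tournament:
  assumes "tournament T" "digraph_iso (G \<restriction> X) T" "u \<in> X" "v \<in> X" "u \<noteq> v"
  shows "adjacent G u v"
proof -
  interpret T: tournament T by (rule assms(1))
  obtain f where f: "pre_digraph.digraph_isomorphism (G \<restriction> X) f" "T = app_iso f (G \<restriction> X)"
    using assms(2) by (auto simp: digraph_iso_def)
  note iso = f(1)[unfolded pre_digraph.digraph_isomorphism_def]
  have inj: "inj_on (iso_verts f) X" using iso by simp
  have dom: "x \<rightarrow>\<^bsub>G\<^esub> y" if xy: "iso_verts f x \<rightarrow>\<^bsub>T\<^esub> iso_verts f y" "x \<in> X" "y \<in> X" for x y
  proof -
    obtain e where e: "e \<in> arcs (G \<restriction> X)" "iso_tail f (iso_arcs f e) = iso_verts f x"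
      "iso_head f (iso_arcs f e) = iso_verts f y"
      using xy(1) by (auto simp: f(2) arcs_ends_conv)
    then have "iso_verts f (tail G e) = iso_verts f x" "iso_verts f (head G e) = iso_verts f y"
      using iso by auto
    moreover have "e \<in> arcs G" "tail G e \<in> X" "head G e \<in> X" using e(1) by auto
    ultimately have "tail G e = x" "head G e = y" using inj xy(2,3) by (auto dest: inj_onD)
    then show ?thesis using \<open>e \<in> arcs G\<close> by (auto simp: arcs_ends_conv)
  qed
  have "iso_verts f u \<noteq> iso_verts f v" using inj assms(3-5) by (auto dest: inj_onD)
  then have "adjacent T (iso_verts f u) (iso_verts f v)"
    using assms(3,4) by (intro T.all_adjacent) (auto simp: f(2))
  then show ?thesis using dom assms(3,4) by (auto simp: T.adjacent_iff adjacent_iff)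
qed

end

section \<open>The Hamilton cycle through \<open>v\<^sub>0\<close>\<close>

theorem theorem1p5:
  fixes D :: "('a, 'b) pre_digraph" and n \<delta> :: nat and v\<^sub>0 :: 'a
  assumes "oriented_graph D"
    and "n = card (verts D)"
    and "\<delta> = min_degree D"
    and "3 \<le> \<delta>" and "real \<delta> \<le> real n / 3"
    and "\<And>u v. \<lbrakk>u \<in> verts D; v \<in> verts D; u \<noteq> v; \<not> adjacent D u v\<rbrakk>
           \<Longrightarrow> degree D u + degree D v \<ge> n"
    and "v\<^sub>0 \<in> verts D" and "degree D v\<^sub>0 = \<delta>"
    and "\<exists>T :: ('a, 'b) pre_digraph. tournament T \<and> digraph_iso (D \<restriction> neighbourhood D v\<^sub>0) T"
  shows "\<exists>C xs. hamilton_oriented_cycle C D \<and> is_traversal C xs \<and>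
           int (sigma_max C xs) \<ge> int n - int \<delta> - 2"
proof -
  interpret oriented_graph D by (rule assms(1))
  interpret rel: oriented_relation "dominates D"
    by unfold_locales (rule no_opposite_arcs)
  have adj: "rel.adj = adjacent D" by (auto simp: rel.adj_def adjacent_iff fun_eq_iff)
  have adj_sym: "adjacent D u v \<longleftrightarrow> adjacent D v u" for u v by (auto simp: adjacent_def)
  define N W s where "N = neighbourhood D v\<^sub>0" and "W = verts D - insert v\<^sub>0 N" and "s = \<delta> - 2"
  have N: "N \<subseteq> verts D" "v\<^sub>0 \<notin> N" by (auto simp: N_def neighbourhood_def adjacent_def)
  have fin: "finite N" "finite W" using finite_subset[OF N(1)] by (auto simp: W_def)
  have cN: "card N = s + 2"
    using assms(4,8) by (simp add: N_def s_def degree_eq_card_neighbourhood)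
  have n3: "3 * \<delta> \<le> n" using assms(5) by linarith
  \<comment> \<open>From \<open>3 * \<delta> \<le> n\<close>, the size
    \<open>n - (\<delta> + 1)\<close> is at least
    \<open>2 * \<delta> - 1 = 2 * s + 3\<close>.\<close>
  have "card W = n - card (insert v\<^sub>0 N)"
    using N fin assms(2,7) by (simp add: W_def card_Diff_subset)
  then have cW: "2 * s + 3 \<le> card W"
    using N(2) fin(1) cN n3 assms(4) by (simp add: s_def)
  have clique: "adjacent D u v" if "u \<in> insert v\<^sub>0 N" "v \<in> insert v\<^sub>0 N" "u \<noteq> v" for u v
  proof -
    have "adjacent D v\<^sub>0 x" if "x \<in> N" for x using that by (simp add: N_def neighbourhood_def)
    then show ?thesis
      using that assms(9) clique_if_iso_tournament[of _ N u v] adj_sym by (auto simp: N_def)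
  qed
  \<comment> \<open>\<open>w\<close>, \<open>v\<^sub>0\<close>, the other non-neighbours of
    \<open>w\<close> and its neighbourhood are disjoint, while the degree condition gives
    \<open>w\<close> degree at least \<open>n - \<delta>\<close>.\<close>
  have few: "card {v \<in> verts D - {v\<^sub>0}. v \<noteq> w \<and> \<not> adjacent D w v} \<le> s" if w: "w \<in> W" for w
  proof -
    have w0: "w \<in> verts D" "w \<noteq> v\<^sub>0" "\<not> adjacent D w v\<^sub>0"
      using w adj_sym by (auto simp: W_def N_def neighbourhood_def)
    let ?M = "{v \<in> verts D - {v\<^sub>0}. v \<noteq> w \<and> \<not> adjacent D w v}"
    have "insert w (insert v\<^sub>0 ?M) \<inter> neighbourhood D w = {}"
      using w0 by (auto simp: neighbourhood_def adjacent_def)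
    moreover have "finite (neighbourhood D w)" by (simp add: neighbourhood_def)
    moreover have "insert w (insert v\<^sub>0 ?M) \<union> neighbourhood D w \<subseteq> verts D"
      using w0 assms(7) by (auto simp: neighbourhood_def)
    ultimately have "card (insert w (insert v\<^sub>0 ?M)) + degree D w \<le> n"
      unfolding assms(2) degree_eq_card_neighbourhood
      by (subst card_Un_disjoint[symmetric]) (auto intro!: card_mono)
    moreover have "card (insert w (insert v\<^sub>0 ?M)) = card ?M + 2" using w0(2) by simp
    moreover have "n \<le> degree D w + \<delta>" using assms(6)[OF w0(1) assms(7) w0(2,3)] assms(8) by simp
    ultimately show ?thesis by (simp add: s_def)
  qed
  \<comment> \<open>Two neighbours in \<open>N\<close> allow the second end to be chosen different
    from the first.\<close>
  have nbrs: "2 \<le> card {x \<in> N. adjacent D w x}" if w: "w \<in> W" for w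
  proof -
    have "card {x \<in> N. \<not> adjacent D w x} \<le> s"
      using w N by (intro le_trans[OF card_mono few[OF w]]) (auto simp: W_def)
    moreover have "card N = card {x \<in> N. adjacent D w x} + card {x \<in> N. \<not> adjacent D w x}"
      using fin(1) by (subst card_Un_disjoint[symmetric]) (auto intro: arg_cong[where f = card])
    ultimately show ?thesis using cN by simp
  qed
  obtain w w' where w: "w \<in> W" "w' \<in> W" "w \<noteq> w'"
    using cW card_le_Suc0_iff_eq[OF fin(2)] by force
  have "{x \<in> N. adjacent D w x} \<noteq> {}" using nbrs[OF w(1)] by (metis card.empty not_numeral_le_zero)
  then obtain b where b: "b \<in> N" "adjacent D w b" by auto
  have "\<not> {x \<in> N. adjacent D w' x} \<subseteq> {b}"
    using nbrs[OF w(2)] card_mono[of "{b}" "{x \<in> N. adjacent D w' x}"] by auto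
  then obtain a where a: "a \<in> N" "adjacent D w' a" "a \<noteq> b" by auto
  interpret linkage "dominates D" W a b s
  proof unfold_locales
    fix u assume u: "u \<in> W"
    show "card {v \<in> insert a (insert b W). v \<noteq> u \<and> \<not> rel.adj u v} \<le> s"
      unfolding adj using u a(1) b(1) N by (intro le_trans[OF card_mono few[OF u]]) (auto simp: W_def)
  qed (use fin a b in \<open>auto simp: W_def\<close>)
  obtain Z where Z: "distinct Z" "set Z = insert a (insert b W)" "{hd Z, last Z} = {a, b}"
    "successively (adjacent D) Z" "breaks (dominates D) Z \<le> s + 2"
    using spanning_linkage[OF cW w] b a adj_sym unfolding adj by metis
  \<comment> \<open>\<open>P\<close> contains \<open>v\<^sub>0\<close>, so it is nonempty; its ends
    are adjacent to \<open>a\<close> and \<open>b\<close> because \<open>insert v\<^sub>0 N\<close>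
    is a clique.\<close>
  obtain P where P: "distinct P" "set P = insert v\<^sub>0 N - {a, b}" "successively (dominates D) P"
    using rel.directed_hamilton_path[of "insert v\<^sub>0 N - {a, b}"] clique fin(1) unfolding adj by auto
  have "v\<^sub>0 \<noteq> a" "v\<^sub>0 \<noteq> b" using a(1) b(1) N(2) by blast+
  then have "v\<^sub>0 \<in> set P" "a \<in> set Z" unfolding P(2) Z(2) by blast+
  then have ne: "P \<noteq> []" "Z \<noteq> []" by auto
  have aP: "successively (adjacent D) P"
    using P(3) by (rule successively_mono) (auto simp: adjacent_iff)
  have Zends: "hd Z \<in> N" "last Z \<in> N" "hd Z \<notin> set P" "last Z \<notin> set P"
  proof -
    have "hd Z \<in> {a, b}" "last Z \<in> {a, b}" unfolding Z(3)[symmetric] by blast+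
    then show "hd Z \<in> N" "last Z \<in> N" "hd Z \<notin> set P" "last Z \<notin> set P"
      using a(1) b(1) by (auto simp: P(2))
  qed
  have Pends: "hd P \<in> set P" "last P \<in> set P"
    by (rule hd_in_set[OF ne(1)], rule last_in_set[OF ne(1)])
  have join: "adjacent D z x" if "z \<in> N" "z \<notin> set P" "x \<in> set P" for z x
  proof (rule clique)
    show "x \<in> insert v\<^sub>0 N" using that(3) unfolding P(2) by (rule DiffD1)
    show "z \<noteq> x" using that(2,3) by metis
  qed (use that(1) in simp)
  have "adjacent D (last Z) (hd P)" "adjacent D (last P) (hd Z)"
    using join[OF Zends(2,4) Pends(1)] join[OF Zends(1,3) Pends(2)] adj_sym by simp_all
  then have closed: "successively (adjacent D) ((Z @ P) @ [hd (Z @ P)])"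
    using ne Z(4) aP by (auto simp: successively_append_iff)
  have dist: "distinct (Z @ P)" "set (Z @ P) = verts D"
  proof -
    have "set Z \<inter> set P = {}" unfolding P(2) Z(2) using N(1) by (auto simp: W_def)
    then show "distinct (Z @ P)" using Z(1) P(1) by simp
    have "set (Z @ P) = W \<union> insert v\<^sub>0 N"
      unfolding set_append P(2) Z(2) using a(1) b(1) by blast
    also have "\<dots> = verts D" using N(1) assms(7) by (auto simp: W_def)
    finally show "set (Z @ P) = verts D" .
  qed
  then have len: "length (Z @ P) = n" using assms(2) by (metis distinct_card)
  then obtain C where C: "hamilton_oriented_cycle C D" "is_traversal C (Z @ P)"
    "n \<le> sigma_plus C (Z @ P) + breaks (dominates D) ((Z @ P) @ [hd (Z @ P)])"
    using hamilton_oriented_cycle_of_list[OF dist _ closed] n3 assms(4) by auto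
  have "breaks (dominates D) P = 0" using P(3) by (simp add: breaks_eq_0_iff)
  \<comment> \<open>\<open>Z\<close> contributes at most \<open>s + 2\<close>, \<open>P\<close>
    nothing, and each of the two joining arcs at most one;
    \<open>s + 4 = \<delta> + 2\<close>.\<close>
  then have "breaks (dominates D) ((Z @ P) @ [hd (Z @ P)]) \<le> s + 4"
    using breaks_append_le[of "dominates D" "Z @ P" "[hd (Z @ P)]"]
      breaks_append_le[of "dominates D" Z P] Z(5) by simp
  then have "int n - int \<delta> - 2 \<le> int (sigma_max C (Z @ P))"
    using C(3) assms(4) by (simp add: s_def sigma_max_def)
  then show ?thesis using C by blast
qed

end
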